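(* Let $(E,\mathscr{T},\le)$ be a topological preordered space such that $(E,\mathscr{T})$ is a $k_\omega$-space and the preorder $\le$ is closed. Then $(E,\mathscr{T},\le)$ is a normally preordered space.
   Context: A preorder is a reflexive and transitive relation; a topological preordered space $(E,\mathscr{T},\le)$ is a set $E$ with a topology $\mathscr{T}$ and a preorder $\le$. No separation axiom (neither Hausdorff nor $T_0$) is assumed on the topology; in particular compactness does not include Hausdorffness. A topological space $E$ is a $k_\omega$-space if there is a countable sequence $K_i$, $i\ge 1$, of compact subsets with $\bigcup_{i=1}^\infty K_i=E$ such that every subset $O\subset E$ is open if and only if $O\cap K_i$ is open in $K_i$ (induced topology) for every $i$. The preorder is closed if its graph $G(\le)=\{(x,y): x\le y\}$ is closed in $E\times E$ (product topology). For $x\in E$, $i(x)=\{y: x\le y\}$ and $d(x)=\{y: y\le x\}$; for $S\subset E$, $i(S)=\bigcup_{x\in S} i(x)$, $d(S)=\bigcup_{x\in S} d(x)$. A set $S$ is increasing if $i(S)=S$ and decreasing if $d(S)=S$. The space is semiclosed preordered if $i(x)$ and $d(x)$ are closed for every $x\in E$. It is normally preordered if it is semiclosed preordered and for every closed decreasing set $A$ and closed increasing set $B$ with $A\cap B=\emptyset$ there are an open decreasing set $U$ and an open increasing set $V$ with $A\subset U$, $B\subset V$, $U\cap V=\emptyset$. *)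

theory Defs
  imports "HOL-Analysis.Analysis"
begin

(* A topological preordered space is a topology X on the set E = topspace X together with a
   relation r such that preorder_on (topspace X) r, where (x, y) \<in> r means x \<le> y.  Then
   i(S) = r `` S and d(S) = r\<inverse> `` S, and for points i(x) = r `` {x} and d(x) = r\<inverse> `` {x}. *)

(* The predicate compactin involves no separation axiom. *)
definition k_omega_space :: "'a topology \<Rightarrow> bool" where
  "k_omega_space X \<longleftrightarrow>
     (\<exists>K :: nat \<Rightarrow> 'a set.
        (\<forall>i. compactin X (K i)) \<and> (\<Union>i. K i) = topspace X \<and>
        (\<forall>S. S \<subseteq> topspace X \<longrightarrow>
           (openin X S \<longleftrightarrow> (\<forall>i. openin (subtopology X (K i)) (S \<inter> K i)))))"

definition closed_preorder :: "'a topology \<Rightarrow> 'a rel \<Rightarrow> bool" where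
  "closed_preorder X r \<longleftrightarrow> preorder_on (topspace X) r \<and> closedin (prod_topology X X) r"

(* For r \<subseteq> E \<times> E both conditions force S \<subseteq> E, since r `` S and r\<inverse> `` S are subsets of E. *)
definition increasing_set :: "'a rel \<Rightarrow> 'a set \<Rightarrow> bool" where
  "increasing_set r S \<longleftrightarrow> r `` S = S"

definition decreasing_set :: "'a rel \<Rightarrow> 'a set \<Rightarrow> bool" where
  "decreasing_set r S \<longleftrightarrow> r\<inverse> `` S = S"

definition semiclosed_preordered :: "'a topology \<Rightarrow> 'a rel \<Rightarrow> bool" where
  "semiclosed_preordered X r \<longleftrightarrow>
     preorder_on (topspace X) r \<and>
     (\<forall>x\<in>topspace X. closedin X (r `` {x}) \<and> closedin X (r\<inverse> `` {x}))"

definition normally_preordered :: "'a topology \<Rightarrow> 'a rel \<Rightarrow> bool" where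
  "normally_preordered X r \<longleftrightarrow>
     semiclosed_preordered X r \<and>
     (\<forall>A B. closedin X A \<and> decreasing_set r A \<and> closedin X B \<and> increasing_set r B \<and> A \<inter> B = {} \<longrightarrow>
        (\<exists>U V. openin X U \<and> decreasing_set r U \<and> openin X V \<and> increasing_set r V \<and>
               A \<subseteq> U \<and> B \<subseteq> V \<and> U \<inter> V = {}))"

end

theory Submission
  imports Defs
begin

text \<open>
  Compactness enters mainly through Wallace's theorem: two compact sets whose product misses the
  graph of a closed relation have open neighbourhoods with the same property. It shows that the
  up-set and the down-set of a compact set are closed (\<open>closedin_Image_compactin\<close>, which for
  points gives semiclosedness), and it yields the enlargement step
  \<open>enlarge_separated_pair\<close>: if \<open>A\<close> is closed decreasing, \<open>B\<close> closed increasing,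
  \<open>A \<inter> B = {}\<close> and \<open>K\<close> is compact, then \<open>A\<close> and \<open>B\<close> can be enlarged to a pair of the same
  kind that contains a neighbourhood, relative to \<open>K\<close>, of \<open>A \<inter> K\<close> and of \<open>B \<inter> K\<close> respectively.

  Let \<open>K\<^sub>i\<close> be compact sets that determine the topology. Starting from the given pair and
  enlarging it at stage \<open>n\<close> along the compact set \<open>K\<^sub>0 \<union> \<dots> \<union> K\<^sub>n\<close> gives increasing sequences
  \<open>A\<^sub>n\<close> and \<open>B\<^sub>n\<close> of closed sets. The union of the \<open>A\<^sub>n\<close> is decreasing, the union of the \<open>B\<^sub>n\<close>
  is increasing, and they are disjoint since the sequences increase and each pair is
  disjoint. Both are open: a point of
  \<open>K\<^sub>m\<close> that lies in \<open>A\<^sub>n\<close> lies in all later ones, so it may be assumed that \<open>n \<ge> m\<close>, and then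
  \<open>A\<^sub>n\<^sub>+\<^sub>1\<close> contains a neighbourhood of it relative to \<open>K\<^sub>m\<close>; thus each union meets every
  \<open>K\<^sub>m\<close> in a relatively open set.
\<close>

section \<open>Closed relations and compact sets\<close>

lemma compactin_separated_by_closed_relation:
  assumes "closedin (prod_topology X Y) r" "compactin X S" "compactin Y T" "S \<times> T \<inter> r = {}"
  obtains P Q where "openin X P" "openin Y Q" "S \<subseteq> P" "T \<subseteq> Q" "P \<times> Q \<inter> r = {}"
proof -
  have "openin (prod_topology X Y) (topspace (prod_topology X Y) - r)"
    using assms(1) by blast
  moreover have "S \<times> T \<subseteq> topspace (prod_topology X Y) - r"
    using assms(4) compactin_subset_topspace[OF assms(2)] compactin_subset_topspace[OF assms(3)]
    by (auto simp: topspace_prod_topology)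
  ultimately obtain P Q where "openin X P" "openin Y Q" "S \<subseteq> P" "T \<subseteq> Q"
      "P \<times> Q \<subseteq> topspace (prod_topology X Y) - r"
    using Wallace_theorem_prod_topology[OF assms(2,3)] by metis
  then show thesis
    by (intro that) auto
qed

lemma closedin_prod_topology_converse:
  assumes "closedin (prod_topology X Y) r"
  shows "closedin (prod_topology Y X) (r\<inverse>)"
proof -
  have "continuous_map (prod_topology Y X) (prod_topology X Y) (\<lambda>(y, x). (x, y))"
    using homeomorphic_map_swap homeomorphic_imp_continuous_map by blast
  from closedin_continuous_map_preimage[OF this assms]
  have "closedin (prod_topology Y X)
          {p \<in> topspace (prod_topology Y X). (\<lambda>(y, x). (x, y)) p \<in> r}" .
  moreover have "{p \<in> topspace (prod_topology Y X). (\<lambda>(y, x). (x, y)) p \<in> r} = r\<inverse>"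
    using closedin_subset[OF assms] by auto
  ultimately show ?thesis by simp
qed

text \<open>A point outside \<open>r `` K\<close> is itself a compact set, so Wallace's theorem separates it from \<open>K\<close>
  by a neighbourhood that misses \<open>r `` K\<close>.\<close>
lemma closedin_Image_compactin:
  assumes r: "closedin (prod_topology X Y) r" and K: "compactin X K"
  shows "closedin Y (r `` K)"
proof -
  have sub: "r `` K \<subseteq> topspace Y"
    using closedin_subset[OF r] by auto
  have "\<exists>Q. openin Y Q \<and> y \<in> Q \<and> Q \<subseteq> topspace Y - r `` K" if y: "y \<in> topspace Y - r `` K" for y
  proof -
    have "K \<times> {y} \<inter> r = {}" "compactin Y {y}"
      using y by auto
    then obtain P Q where "openin X P" "openin Y Q" "K \<subseteq> P" "{y} \<subseteq> Q" "P \<times> Q \<inter> r = {}"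
      using compactin_separated_by_closed_relation[OF r K] by metis
    then show ?thesis
      using openin_subset by (intro exI[of _ Q]) fastforce
  qed
  then have "openin Y (topspace Y - r `` K)"
    using openin_subopen by blast
  then show ?thesis
    using sub by (simp add: closedin_def)
qed

lemma closedin_converse_Image_compactin:
  assumes "closedin (prod_topology X Y) r" "compactin Y K"
  shows "closedin X (r\<inverse> `` K)"
  using closedin_Image_compactin[OF closedin_prod_topology_converse] assms by blast

section \<open>Enlarging a separated pair along a compact set\<close>

lemma compactin_diff_openin:
  assumes "compactin X K" "openin X W"
  shows "compactin X (K - W)"
proof -
  have "K - W = (topspace X - W) \<inter> K"
    using compactin_subset_topspace[OF assms(1)] by auto
  then show ?thesis
    using closed_Int_compactin[of X "topspace X - W" K] assms by auto
qed

definition separated_pair :: "'a topology \<Rightarrow> 'a rel \<Rightarrow> 'a set \<Rightarrow> 'a set \<Rightarrow> bool" where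
  "separated_pair X r A B \<longleftrightarrow>
     closedin X A \<and> decreasing_set r A \<and> closedin X B \<and> increasing_set r B \<and> A \<inter> B = {}"

definition contains_nhd_within :: "'a topology \<Rightarrow> 'a set \<Rightarrow> 'a set \<Rightarrow> 'a set \<Rightarrow> bool" where
  "contains_nhd_within X K A A' \<longleftrightarrow> (\<exists>P. openin X P \<and> A \<inter> K \<subseteq> P \<and> P \<inter> K \<subseteq> A')"

text \<open>The enlarged sets are \<open>A \<union> d(C)\<close> and \<open>B \<union> i(D)\<close>, where \<open>C\<close> and \<open>D\<close> are compact
  neighbourhoods, relative to \<open>K\<close>, of \<open>A \<inter> K\<close> and \<open>B \<inter> K\<close>. The adjoined sets are closed by
  compactness and monotone by transitivity. Two points related by \<open>b \<le> a\<close> cannot satisfy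
  \<open>b \<in> B\<close> and \<open>a \<in> A\<close>, so Wallace's theorem applies to \<open>B \<inter> K\<close> and \<open>A \<inter> K\<close>. The sets
  \<open>C\<close> and \<open>D\<close> are obtained as complements in \<open>K\<close> of open sets: if no point of \<open>Q\<close> is below a
  point of \<open>P\<close>, then \<open>Q\<close> and \<open>P\<close> are disjoint by reflexivity, so \<open>K - P\<close> contains \<open>Q \<inter> K\<close>.
  Disjointness of \<open>d(C)\<close> and \<open>i(D)\<close> reduces by transitivity to \<open>C \<inter> i(D) = {}\<close>.\<close>
lemma enlarge_separated_pair:
  assumes r: "closed_preorder X r" and K: "compactin X K" and AB: "separated_pair X r A B"
  shows "\<exists>A' B'. separated_pair X r A' B' \<and> A \<subseteq> A' \<and> B \<subseteq> B' \<and>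
           contains_nhd_within X K A A' \<and> contains_nhd_within X K B B'"
proof -
  have clr: "closedin (prod_topology X X) r" and tr: "trans r" and refl: "refl_on (topspace X) r"
    using r unfolding closed_preorder_def preorder_on_def by auto
  have KX: "K \<subseteq> topspace X" and rX: "r \<subseteq> topspace X \<times> topspace X"
    using compactin_subset_topspace[OF K] closedin_subset[OF clr] by auto
  have self: "(x, x) \<in> r" if "x \<in> K" for x
    using that refl KX by (auto dest: refl_onD)
  have image_idem: "r `` r `` S = r `` S" "r\<inverse> `` r\<inverse> `` S = r\<inverse> `` S" for S
  proof -
    have "r O r = r"
    proof
      show "r O r \<subseteq> r"
        using tr by (simp add: trans_O_subset)
      show "r \<subseteq> r O r"
        using refl rX by (auto dest: refl_onD)
    qed
    then show "r `` r `` S = r `` S" "r\<inverse> `` r\<inverse> `` S = r\<inverse> `` S"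
      by (metis relcomp_Image, metis relcomp_Image converse_relcomp)
  qed
  have clA: "closedin X A" and clB: "closedin X B" and disj: "A \<inter> B = {}"
    using AB unfolding separated_pair_def by auto
  have dA: "x \<in> A" if "(x, y) \<in> r" "y \<in> A" for x y
    using AB that unfolding separated_pair_def decreasing_set_def by blast
  have iB: "y \<in> B" if "(x, y) \<in> r" "x \<in> B" for x y
    using AB that unfolding separated_pair_def increasing_set_def by blast

  have cA: "compactin X (A \<inter> K)" and cB: "compactin X (B \<inter> K)"
    using closed_Int_compactin clA clB K by auto
  have "(B \<inter> K) \<times> (A \<inter> K) \<inter> r = {}"
    using dA disj by blast
  then obtain Q P where QP: "openin X Q" "openin X P" "B \<inter> K \<subseteq> Q" "A \<inter> K \<subseteq> P" "Q \<times> P \<inter> r = {}"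
    using compactin_separated_by_closed_relation[OF clr cB cA] by metis

  define D where "D = K - P"
  have cD: "compactin X D"
    unfolding D_def using compactin_diff_openin[OF K QP(2)] .
  have clD: "closedin X (r `` D)"
    using closedin_Image_compactin[OF clr cD] .
  have DA: "r `` D \<inter> A = {}"
    using dA QP(4) unfolding D_def by blast
  have QD: "Q \<inter> K \<subseteq> D"
    using QP(5) self unfolding D_def by blast

  \<comment> \<open>A second separation, now of \<open>A\<close> from the up-set of \<open>D\<close>, leaves room between the two
    neighbourhoods: the compact set \<open>C\<close> contains a neighbourhood of \<open>A \<inter> K\<close> and avoids that up-set.\<close>
  have cDK: "compactin X (r `` D \<inter> K)"
    using closed_Int_compactin[OF clD K] .
  have "(r `` D \<inter> K) \<times> (A \<inter> K) \<inter> r = {}"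
    using dA DA by blast
  then obtain W P' where WP: "openin X W" "openin X P'" "r `` D \<inter> K \<subseteq> W" "A \<inter> K \<subseteq> P'"
      "W \<times> P' \<inter> r = {}"
    using compactin_separated_by_closed_relation[OF clr cDK cA] by metis
  define C where "C = K - W"
  have cC: "compactin X C"
    unfolding C_def using compactin_diff_openin[OF K WP(1)] .
  have clC: "closedin X (r\<inverse> `` C)"
    using closedin_converse_Image_compactin[OF clr cC] .
  have PC: "P' \<inter> K \<subseteq> C"
    using WP(5) self unfolding C_def by blast
  have CD: "C \<inter> r `` D = {}"
    using WP(3) unfolding C_def by blast

  have "r\<inverse> `` C \<inter> r `` D = {}"
    using CD tr by (blast dest: transD)
  moreover have "r\<inverse> `` C \<inter> B = {}"
  proof (rule ccontr)
    assume "r\<inverse> `` C \<inter> B \<noteq> {}"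
    then obtain b c where "b \<in> B" "c \<in> C" "(b, c) \<in> r" by blast
    then have "c \<in> B \<inter> K"
      using iB unfolding C_def by blast
    then have "c \<in> r `` D"
      using QP(3) QD self by blast
    then show False
      using CD \<open>c \<in> C\<close> by blast
  qed
  ultimately have disj': "(A \<union> r\<inverse> `` C) \<inter> (B \<union> r `` D) = {}"
    using disj DA by blast
  have "decreasing_set r (A \<union> r\<inverse> `` C)" "increasing_set r (B \<union> r `` D)"
    using AB image_idem unfolding separated_pair_def decreasing_set_def increasing_set_def
    by (simp_all add: Image_Un)
  then have "separated_pair X r (A \<union> r\<inverse> `` C) (B \<union> r `` D)"
    using disj' clA clB clC clD unfolding separated_pair_def by (simp add: closedin_Un)
  moreover have "P' \<inter> K \<subseteq> A \<union> r\<inverse> `` C" "Q \<inter> K \<subseteq> B \<union> r `` D"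
    using PC QD self by blast+
  then have "contains_nhd_within X K A (A \<union> r\<inverse> `` C)" "contains_nhd_within X K B (B \<union> r `` D)"
    using WP(2,4) QP(1,3) unfolding contains_nhd_within_def by blast+
  ultimately show ?thesis
    by blast
qed

section \<open>Passage to the limit\<close>

text \<open>From stage \<open>m\<close> on, the set \<open>T\<close> is contained in \<open>L n\<close>. Since the sequence is increasing, a
  point of \<open>T\<close> in the union lies in some \<open>S n\<close> with \<open>n \<ge> m\<close>, and the next stage contains a
  neighbourhood of it relative to \<open>T\<close>.\<close>
lemma openin_subtopology_UN_enlarging:
  assumes step: "\<And>n. S n \<subseteq> S (Suc n)"
    and nhd: "\<And>n. contains_nhd_within X (L n) (S n) (S (Suc n))"
    and T: "\<And>n. m \<le> n \<Longrightarrow> T \<subseteq> L n"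
  shows "openin (subtopology X T) ((\<Union>n. S n) \<inter> T)"
proof (subst openin_subopen, intro ballI)
  fix x assume x: "x \<in> (\<Union>n. S n) \<inter> T"
  have mono: "S i \<subseteq> S j" if "i \<le> j" for i j
    using lift_Suc_mono_le[of S, OF step that] .
  obtain k where k: "x \<in> S k"
    using x by blast
  define n where "n = max k m"
  have xn: "x \<in> S n" and Tn: "T \<subseteq> L n"
    using k mono[of k n] T[of n] unfolding n_def by auto
  obtain P where P: "openin X P" "S n \<inter> L n \<subseteq> P" "P \<inter> L n \<subseteq> S (Suc n)"
    using nhd[of n] unfolding contains_nhd_within_def by blast
  have "openin (subtopology X T) (P \<inter> T)"
    using P(1) by (rule openin_subtopology_Int)
  moreover have "x \<in> P \<inter> T" "P \<inter> T \<subseteq> (\<Union>n. S n) \<inter> T"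
    using x xn Tn P(2,3) by blast+
  ultimately show "\<exists>U. openin (subtopology X T) U \<and> x \<in> U \<and> U \<subseteq> (\<Union>n. S n) \<inter> T"
    by blast
qed

theorem theorem2p7:
  fixes X :: "'a topology" and r :: "'a rel"
  assumes "k_omega_space X"
    and "closed_preorder X r"
  shows "normally_preordered X r"
proof -
  have clr: "closedin (prod_topology X X) r" and pre: "preorder_on (topspace X) r"
    using assms(2) unfolding closed_preorder_def by auto
  have "semiclosed_preordered X r"
    unfolding semiclosed_preordered_def
    using pre closedin_Image_compactin[OF clr] closedin_converse_Image_compactin[OF clr]
    by simp
  moreover have "\<exists>U V. openin X U \<and> decreasing_set r U \<and> openin X V \<and> increasing_set r V \<and>
               A \<subseteq> U \<and> B \<subseteq> V \<and> U \<inter> V = {}" if AB: "separated_pair X r A B" for A B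
  proof -
    obtain K :: "nat \<Rightarrow> 'a set" where K: "\<And>i. compactin X (K i)"
      and gen: "\<And>S. S \<subseteq> topspace X \<Longrightarrow> (\<And>i. openin (subtopology X (K i)) (S \<inter> K i)) \<Longrightarrow> openin X S"
      using assms(1) unfolding k_omega_space_def by metis
    define L where "L n = (\<Union>i\<le>n. K i)" for n
    have L: "compactin X (L n)" for n
      unfolding L_def using K by (intro compactin_Union) auto
    have KL: "K i \<subseteq> L n" if "i \<le> n" for i n
      using that unfolding L_def by blast
    \<comment> \<open>The conjunct for \<open>n = 0\<close> makes the sequence given by dependent choice start at \<open>(A, B)\<close>.\<close>
    have "\<exists>p. \<forall>n. separated_pair X r (fst (p n)) (snd (p n)) \<and> (n = 0 \<longrightarrow> p n = (A, B)) \<and>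
            (fst (p n) \<subseteq> fst (p (Suc n)) \<and> snd (p n) \<subseteq> snd (p (Suc n)) \<and>
             contains_nhd_within X (L n) (fst (p n)) (fst (p (Suc n))) \<and>
             contains_nhd_within X (L n) (snd (p n)) (snd (p (Suc n))))"
      (is "\<exists>p. \<forall>n. ?sep n (p n) \<and> ?init n (p n) \<and> ?next n (p n) (p (Suc n))")
    proof -
      have "\<exists>p. \<forall>n. (?sep n (p n) \<and> ?init n (p n)) \<and> ?next n (p n) (p (Suc n))"
      proof (rule dependent_nat_choice)
        show "\<exists>x. ?sep 0 x \<and> ?init 0 x"
          using AB by auto
        show "\<exists>y. (?sep (Suc n) y \<and> ?init (Suc n) y) \<and> ?next n x y"
          if "?sep n x \<and> ?init n x" for x n
          using enlarge_separated_pair[OF assms(2) L[of n], of "fst x" "snd x"] that by auto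
      qed
      then show ?thesis by (simp only: conj_assoc)
    qed
    then obtain p where sep: "\<And>n. separated_pair X r (fst (p n)) (snd (p n))"
      and p0: "p 0 = (A, B)"
      and stepA: "\<And>n. fst (p n) \<subseteq> fst (p (Suc n))" and stepB: "\<And>n. snd (p n) \<subseteq> snd (p (Suc n))"
      and nhdA: "\<And>n. contains_nhd_within X (L n) (fst (p n)) (fst (p (Suc n)))"
      and nhdB: "\<And>n. contains_nhd_within X (L n) (snd (p n)) (snd (p (Suc n)))"
      by blast
    define U V where "U = (\<Union>n. fst (p n))" and "V = (\<Union>n. snd (p n))"
    have subA: "fst (p n) \<subseteq> topspace X" and subB: "snd (p n) \<subseteq> topspace X" for n
      using sep[of n] closedin_subset unfolding separated_pair_def by auto
    have "openin X U" unfolding U_def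
      by (rule gen) (use subA openin_subtopology_UN_enlarging[where S = "\<lambda>n. fst (p n)", OF stepA nhdA KL] in auto)
    moreover have "openin X V" unfolding V_def
      by (rule gen) (use subB openin_subtopology_UN_enlarging[where S = "\<lambda>n. snd (p n)", OF stepB nhdB KL] in auto)
    moreover have "decreasing_set r U" "increasing_set r V"
      using sep unfolding U_def V_def separated_pair_def decreasing_set_def increasing_set_def
      by (simp_all add: Image_UN)
    moreover have "A \<subseteq> U" "B \<subseteq> V"
      using p0 unfolding U_def V_def by (metis UN_upper UNIV_I fst_conv, metis UN_upper UNIV_I snd_conv)
    moreover have "U \<inter> V = {}"
    proof (rule ccontr)
      assume "U \<inter> V \<noteq> {}"
      then obtain x i j where x: "x \<in> fst (p i)" "x \<in> snd (p j)"
        unfolding U_def V_def by blast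
      have "x \<in> fst (p (max i j))" "x \<in> snd (p (max i j))"
        using x lift_Suc_mono_le[of "\<lambda>n. fst (p n)", OF stepA, of i "max i j"]
          lift_Suc_mono_le[of "\<lambda>n. snd (p n)", OF stepB, of j "max i j"] by auto
      then show False
        using sep[of "max i j"] unfolding separated_pair_def by blast
    qed
    ultimately show ?thesis
      by blast
  qed
  ultimately show ?thesis
    unfolding normally_preordered_def separated_pair_def by blast
qed

end
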